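(* Given two states $s_0$ and $t_0$ in a finitary pLTS, the procedure $\mathbf{Bisim}(s_0,t_0)$ terminates, and it returns true if and only if $s_0\sim t_0$.
   Context: A pLTS is $\langle S,A,\to\rangle$ with ${\to}\subseteq S\times A\times\mathcal{D}(S)$ ($\mathcal{D}(S)$ finitely supported probability distributions, $\lceil\Delta\rceil$ the support); it is finitary if $S$ is finite and each state has finitely many outgoing transitions. Lifting $\overline{\mathcal{R}}$ of $\mathcal{R}\subseteq S\times S$: smallest relation on $\mathcal{D}(S)$ with $\overline{s}\,\overline{\mathcal{R}}\,\overline{t}$ whenever $s\mathcal{R}t$ ($\overline{s}$ point distribution) and closed under finite convex combinations. $\mathcal{R}$ is a probabilistic bisimulation if for $\mathcal{R}$ and $\mathcal{R}^{-1}$: $s\mathcal{R}t$, $s\xrightarrow{a}\Delta$ imply $t\xrightarrow{a}\Theta$ with $\Delta\overline{\mathcal{R}}\Theta$ for some $\Theta$; $\sim$ is the largest one. Procedure $\mathbf{Check}(\Delta,\Theta,\mathcal{R})$ returns yes iff $\Delta\,\overline{\mathcal{R}}\,\Theta$ (computed as: the maximum flow in the network with nodes $S$, a disjoint copy $S'$, source $\bot$, sink $\top$, edges $\bot\to s$ of capacity $\Delta(s)$, $t'\to\top$ of capacity $\Theta(t)$, and $s\to t'$ of capacity 1 for $(s,t)\in\mathcal{R}$, equals 1). Algorithm $\mathbf{Bisim}(s,t)$: a global set $NotBisim:=\emptyset$; function $\mathbf{Bis}(s,t)$ sets $Visited:=\emptyset$, $Assumed:=\emptyset$ and returns $\mathbf{Match}(s,t)$;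 if the exception $WrongAssumption$ is raised during $\mathbf{Bis}(s,t)$, then $\mathbf{Bis}(s,t)$ is called again (keeping $NotBisim$); $\mathbf{Bisim}$ returns the result of $\mathbf{Bis}(s,t)$. $\mathbf{Match}(s,t)$: add $(s,t)$ to $Visited$; $b:=\bigwedge_{a\in A}\mathbf{MatchAction}(s,t,a)$; if $b$ is false, add $(s,t)$ to $NotBisim$ and, if $(s,t)\in Assumed$, raise $WrongAssumption$; return $b$. $\mathbf{MatchAction}(s,t,a)$: for all transitions $s\xrightarrow{a}\Delta_i$ and $t\xrightarrow{a}\Theta_j$ compute $b_{ij}:=\mathbf{MatchDistribution}(\Delta_i,\Theta_j)$; return $(\bigwedge_i\bigvee_j b_{ij})\wedge(\bigwedge_j\bigvee_i b_{ij})$. $\mathbf{MatchDistribution}(\Delta,\Theta)$: let $\mathcal{R}:=\{(u,v):u\in\lceil\Delta\rceil,v\in\lceil\Theta\rceil,\mathbf{Close}(u,v)=\mathit{true}\}$ and return $\mathbf{Check}(\Delta,\Theta,\mathcal{R})$. $\mathbf{Close}(u,v)$: if $(u,v)\in NotBisim$ return false; else if $(u,v)\in Visited$, add $(u,v)$ to $Assumed$ and return true; else return $\mathbf{Match}(u,v)$. *)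

theory Defs
  imports "HOL-Probability.Probability"
begin

section \<open>Probabilistic labelled transition systems and bisimilarity\<close>

record ('s, 'a) plts =
  states :: "'s set"
  actions :: "'a set"
  transitions :: "('s \<times> 'a \<times> 's pmf) set"

definition dists :: "'s set \<Rightarrow> 's pmf set" where
  "dists S = {\<Delta>. finite (set_pmf \<Delta>) \<and> set_pmf \<Delta> \<subseteq> S}"

definition is_plts :: "('s, 'a) plts \<Rightarrow> bool" where
  "is_plts P \<longleftrightarrow> transitions P \<subseteq> states P \<times> actions P \<times> dists (states P)"

definition finitary :: "('s, 'a) plts \<Rightarrow> bool" where
  "finitary P \<longleftrightarrow> finite (states P) \<and>
     (\<forall>s\<in>states P. finite {(a, \<Delta>). (s, a, \<Delta>) \<in> transitions P})"

definition derivatives :: "('s, 'a) plts \<Rightarrow> 's \<Rightarrow> 'a \<Rightarrow> 's pmf set" where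
  "derivatives P s a = {\<Delta>. (s, a, \<Delta>) \<in> transitions P}"

text \<open>For \<open>R \<subseteq> S \<times> S\<close>, all distributions related by \<open>lifting R\<close> are automatically in \<open>dists S\<close>.\<close>

inductive lifting :: "('s \<times> 's) set \<Rightarrow> 's pmf \<Rightarrow> 's pmf \<Rightarrow> bool" for R where
  point: "(s, t) \<in> R \<Longrightarrow> lifting R (return_pmf s) (return_pmf t)"
| convex: "\<lbrakk>\<And>i. i < (n::nat) \<Longrightarrow> lifting R (D i) (T i);
            \<And>i. i < n \<Longrightarrow> 0 \<le> p i; (\<Sum>i<n. p i) = (1::real);
            \<And>x. pmf \<Delta> x = (\<Sum>i<n. p i * pmf (D i) x);
            \<And>x. pmf \<Theta> x = (\<Sum>i<n. p i * pmf (T i) x)\<rbrakk>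
           \<Longrightarrow> lifting R \<Delta> \<Theta>"

definition simulates :: "('s, 'a) plts \<Rightarrow> ('s \<times> 's) set \<Rightarrow> bool" where
  "simulates P R \<longleftrightarrow> (\<forall>s t a \<Delta>. (s, t) \<in> R \<and> (s, a, \<Delta>) \<in> transitions P \<longrightarrow>
     (\<exists>\<Theta>. (t, a, \<Theta>) \<in> transitions P \<and> lifting R \<Delta> \<Theta>))"

definition prob_bisimulation :: "('s, 'a) plts \<Rightarrow> ('s \<times> 's) set \<Rightarrow> bool" where
  "prob_bisimulation P R \<longleftrightarrow>
     R \<subseteq> states P \<times> states P \<and> simulates P R \<and> simulates P (R\<inverse>)"

definition bisimilarity :: "('s, 'a) plts \<Rightarrow> ('s \<times> 's) set" where
  "bisimilarity P = \<Union>{R. prob_bisimulation P R}"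

lemma lifting_mono:
  assumes "lifting R \<Delta> \<Theta>" "R \<subseteq> R'"
  shows "lifting R' \<Delta> \<Theta>"
  using assms
proof induction
  case (point s t)
  then show ?case by (auto intro: lifting.point)
next
  case (convex n D T p \<Delta> \<Theta>)
  show ?case
    by (rule lifting.convex[where n = n and D = D and T = T and p = p]) (use convex in auto)
qed

lemma simulates_Union:
  assumes "\<And>R. R \<in> F \<Longrightarrow> simulates P R"
  shows "simulates P (\<Union>F)"
  unfolding simulates_def
proof (intro allI impI)
  fix s t a \<Delta>
  assume *: "(s, t) \<in> \<Union>F \<and> (s, a, \<Delta>) \<in> transitions P"
  then obtain R where R: "R \<in> F" "(s, t) \<in> R" by auto
  with assms * obtain \<Theta> where "(t, a, \<Theta>) \<in> transitions P" "lifting R \<Delta> \<Theta>"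
    unfolding simulates_def by meson
  with R show "\<exists>\<Theta>. (t, a, \<Theta>) \<in> transitions P \<and> lifting (\<Union>F) \<Delta> \<Theta>"
    by (meson Union_upper lifting_mono)
qed

lemma bisimilarity_largest:
  "prob_bisimulation P (bisimilarity P)"
  "prob_bisimulation P R \<Longrightarrow> R \<subseteq> bisimilarity P"
proof -
  have conv: "(bisimilarity P)\<inverse> = \<Union>{R\<inverse> |R. prob_bisimulation P R}"
    unfolding bisimilarity_def by auto
  have "simulates P ((bisimilarity P)\<inverse>)"
    unfolding conv by (rule simulates_Union) (auto simp: prob_bisimulation_def)
  moreover have "simulates P (bisimilarity P)"
    unfolding bisimilarity_def by (rule simulates_Union) (auto simp: prob_bisimulation_def)
  ultimately show "prob_bisimulation P (bisimilarity P)"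
    unfolding prob_bisimulation_def by (auto simp: bisimilarity_def prob_bisimulation_def)
qed (auto simp: bisimilarity_def)


section \<open>Maximum flows and \<open>Check\<close>\<close>

definition is_flow ::
  "'v set \<Rightarrow> 'v \<Rightarrow> 'v \<Rightarrow> ('v \<Rightarrow> 'v \<Rightarrow> real) \<Rightarrow> ('v \<Rightarrow> 'v \<Rightarrow> real) \<Rightarrow> bool" where
  "is_flow N src snk c f \<longleftrightarrow>
     (\<forall>u\<in>N. \<forall>v\<in>N. 0 \<le> f u v \<and> f u v \<le> c u v) \<and>
     (\<forall>v\<in>N - {src, snk}. (\<Sum>u\<in>N. f u v) = (\<Sum>u\<in>N. f v u))"

definition flow_value :: "'v set \<Rightarrow> 'v \<Rightarrow> ('v \<Rightarrow> 'v \<Rightarrow> real) \<Rightarrow> real" where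
  "flow_value N src f = (\<Sum>v\<in>N. f src v) - (\<Sum>v\<in>N. f v src)"

definition is_max_flow ::
  "'v set \<Rightarrow> 'v \<Rightarrow> 'v \<Rightarrow> ('v \<Rightarrow> 'v \<Rightarrow> real) \<Rightarrow> ('v \<Rightarrow> 'v \<Rightarrow> real) \<Rightarrow> bool" where
  "is_max_flow N src snk c f \<longleftrightarrow> is_flow N src snk c f \<and>
     (\<forall>g. is_flow N src snk c g \<longrightarrow> flow_value N src g \<le> flow_value N src f)"

datatype 's node = Source | Orig 's | Copy 's | Sink

definition nodes :: "'s set \<Rightarrow> 's node set" where
  "nodes S = {Source, Sink} \<union> Orig ` S \<union> Copy ` S"

text \<open>Absent edges have capacity 0.\<close>

fun capacity :: "'s pmf \<Rightarrow> 's pmf \<Rightarrow> ('s \<times> 's) set \<Rightarrow> 's node \<Rightarrow> 's node \<Rightarrow> real" where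
  "capacity \<Delta> \<Theta> R Source (Orig s) = pmf \<Delta> s"
| "capacity \<Delta> \<Theta> R (Copy t) Sink = pmf \<Theta> t"
| "capacity \<Delta> \<Theta> R (Orig s) (Copy t) = (if (s, t) \<in> R then 1 else 0)"
| "capacity \<Delta> \<Theta> R _ _ = 0"

definition Check :: "('s, 'a) plts \<Rightarrow> 's pmf \<Rightarrow> 's pmf \<Rightarrow> ('s \<times> 's) set \<Rightarrow> bool" where
  "Check P \<Delta> \<Theta> R \<longleftrightarrow>
     (\<exists>f. is_max_flow (nodes (states P)) Source Sink (capacity \<Delta> \<Theta> R) f \<and>
          flow_value (nodes (states P)) Source f = 1)"


section \<open>Programs with a store, an exception and possible nontermination\<close>

record 's store =
  NotBisim :: "('s \<times> 's) set"
  Visited :: "('s \<times> 's) set"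
  Assumed :: "('s \<times> 's) set"

datatype 'r outcome = Returned 'r | WrongAssumption

text \<open>
  The result \<open>None\<close> means that the program does not terminate. Recursive programs are defined by
  \<open>partial_function (option)\<close>, that is, as least fixed points for the order in which \<open>None\<close> is
  the least element; hence a program yields \<open>Some\<close> exactly if its recursion unwinds after finitely
  many steps. An exception keeps the store in which it is raised.
\<close>

type_synonym ('s, 'r) prog = "'s store \<Rightarrow> ('r outcome \<times> 's store) option"

definition ret :: "'r \<Rightarrow> ('s, 'r) prog" where
  "ret r = (\<lambda>\<sigma>. Some (Returned r, \<sigma>))"

definition raise_wrong :: "('s, 'r) prog" where
  "raise_wrong = (\<lambda>\<sigma>. Some (WrongAssumption, \<sigma>))"

definition get :: "('s, 's store) prog" where
  "get = (\<lambda>\<sigma>. Some (Returned \<sigma>, \<sigma>))"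

definition modify :: "('s store \<Rightarrow> 's store) \<Rightarrow> ('s, unit) prog" where
  "modify h = (\<lambda>\<sigma>. Some (Returned (), h \<sigma>))"

definition prog_bind :: "('s, 'q) prog \<Rightarrow> ('q \<Rightarrow> ('s, 'r) prog) \<Rightarrow> ('s, 'r) prog" where
  "prog_bind m k = (\<lambda>\<sigma>. Option.bind (m \<sigma>) (\<lambda>(out, \<sigma>').
     case out of Returned q \<Rightarrow> k q \<sigma>' | WrongAssumption \<Rightarrow> Some (WrongAssumption, \<sigma>')))"

adhoc_overloading Monad_Syntax.bind \<rightleftharpoons> prog_bind

text \<open>
  \<open>select b xs\<close> runs the Boolean program \<open>b x\<close> once for each entry \<open>x\<close> of \<open>xs\<close>, from left to
  right and without short-circuiting, and returns the set of those \<open>x\<close> for which the result was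
  \<open>True\<close>.
\<close>

primrec select :: "('x \<Rightarrow> ('s, bool) prog) \<Rightarrow> 'x list \<Rightarrow> ('s, 'x set) prog" where
  "select b [] = ret {}"
| "select b (x # xs) = do {
     r \<leftarrow> b x;
     X \<leftarrow> select b xs;
     ret (if r then insert x X else X)
   }"


section \<open>The algorithm\<close>

text \<open>
  The algorithm does not fix the order in which its loops run through actions, pairs of
  transitions and pairs of states. These orders are supplied by an arbitrary \<open>schedule\<close>; they may
  depend on the store when the loop is entered.
\<close>

record ('s, 'a) schedule =
  action_order :: "'s store \<Rightarrow> 's \<Rightarrow> 's \<Rightarrow> 'a list"
  transition_order :: "'s store \<Rightarrow> 's \<Rightarrow> 's \<Rightarrow> 'a \<Rightarrow> ('s pmf \<times> 's pmf) list"
  support_order :: "'s store \<Rightarrow> 's pmf \<Rightarrow> 's pmf \<Rightarrow> ('s \<times> 's) list"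

text \<open>
  The set of actions may be infinite even if the pLTS is finitary. An action enabled neither in
  \<open>s\<close> nor in \<open>t\<close> contributes an empty, hence true, conjunct without side effects to the conjunction
  over all actions, so that the loop runs through the remaining actions only.
\<close>

definition enabled :: "('s, 'a) plts \<Rightarrow> 's \<Rightarrow> 's \<Rightarrow> 'a set" where
  "enabled P s t = {a \<in> actions P. derivatives P s a \<noteq> {} \<or> derivatives P t a \<noteq> {}}"

definition enumerates :: "'x list \<Rightarrow> 'x set \<Rightarrow> bool" where
  "enumerates xs X \<longleftrightarrow> distinct xs \<and> set xs = X"

definition is_schedule :: "('s, 'a) plts \<Rightarrow> ('s, 'a) schedule \<Rightarrow> bool" where
  "is_schedule P sc \<longleftrightarrow>
     (\<forall>\<sigma>. \<forall>s\<in>states P. \<forall>t\<in>states P. enumerates (action_order sc \<sigma> s t) (enabled P s t)) \<and>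
     (\<forall>\<sigma>. \<forall>s\<in>states P. \<forall>t\<in>states P. \<forall>a\<in>actions P.
        enumerates (transition_order sc \<sigma> s t a) (derivatives P s a \<times> derivatives P t a)) \<and>
     (\<forall>\<sigma>. \<forall>\<Delta>\<in>dists (states P). \<forall>\<Theta>\<in>dists (states P).
        enumerates (support_order sc \<sigma> \<Delta> \<Theta>) (set_pmf \<Delta> \<times> set_pmf \<Theta>))"

text \<open>
  \<open>Match\<close>, \<open>MatchAction\<close>, \<open>MatchDistribution\<close> and \<open>Close\<close> are mutually recursive. All but \<open>Match\<close>
  take the procedure \<open>m\<close> to be called for \<open>Match\<close> as an argument; the recursion is closed in the
  definition of \<open>Match\<close>.
\<close>

definition Close :: "('s \<Rightarrow> 's \<Rightarrow> ('s, bool) prog) \<Rightarrow> 's \<Rightarrow> 's \<Rightarrow> ('s, bool) prog" where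
  "Close m u v = do {
     \<sigma> \<leftarrow> get;
     if (u, v) \<in> NotBisim \<sigma> then ret False
     else if (u, v) \<in> Visited \<sigma> then do {
       modify (Assumed_update (insert (u, v)));
       ret True
     }
     else m u v
   }"

definition MatchDistribution ::
  "('s, 'a) plts \<Rightarrow> ('s, 'a) schedule \<Rightarrow> ('s \<Rightarrow> 's \<Rightarrow> ('s, bool) prog) \<Rightarrow>
   's pmf \<Rightarrow> 's pmf \<Rightarrow> ('s, bool) prog" where
  "MatchDistribution P sc m \<Delta> \<Theta> = do {
     \<sigma> \<leftarrow> get;
     R \<leftarrow> select (\<lambda>(u, v). Close m u v) (support_order sc \<sigma> \<Delta> \<Theta>);
     ret (Check P \<Delta> \<Theta> R)
   }"

definition MatchAction ::
  "('s, 'a) plts \<Rightarrow> ('s, 'a) schedule \<Rightarrow> ('s \<Rightarrow> 's \<Rightarrow> ('s, bool) prog) \<Rightarrow>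
   's \<Rightarrow> 's \<Rightarrow> 'a \<Rightarrow> ('s, bool) prog" where
  "MatchAction P sc m s t a = do {
     \<sigma> \<leftarrow> get;
     B \<leftarrow> select (\<lambda>(\<Delta>, \<Theta>). MatchDistribution P sc m \<Delta> \<Theta>) (transition_order sc \<sigma> s t a);
     ret ((\<forall>\<Delta>\<in>derivatives P s a. \<exists>\<Theta>\<in>derivatives P t a. (\<Delta>, \<Theta>) \<in> B) \<and>
          (\<forall>\<Theta>\<in>derivatives P t a. \<exists>\<Delta>\<in>derivatives P s a. (\<Delta>, \<Theta>) \<in> B))
   }"

definition Match_body ::
  "('s, 'a) plts \<Rightarrow> ('s, 'a) schedule \<Rightarrow> ('s \<Rightarrow> 's \<Rightarrow> ('s, bool) prog) \<Rightarrow>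
   's \<Rightarrow> 's \<Rightarrow> ('s, bool) prog" where
  "Match_body P sc m s t = do {
     modify (Visited_update (insert (s, t)));
     \<sigma> \<leftarrow> get;
     X \<leftarrow> select (MatchAction P sc m s t) (action_order sc \<sigma> s t);
     let b = (\<forall>a\<in>enabled P s t. a \<in> X);
     if b then ret True
     else do {
       modify (NotBisim_update (insert (s, t)));
       \<sigma>' \<leftarrow> get;
       if (s, t) \<in> Assumed \<sigma>' then raise_wrong else ret False
     }
   }"

text \<open>Monotonicity in \<open>m\<close>, as required by \<open>partial_function\<close>.\<close>

lemma prog_bind_mono:
  assumes "\<And>\<sigma>. mono_option (\<lambda>f. m f \<sigma>)" "\<And>q \<sigma>. mono_option (\<lambda>f. k f q \<sigma>)"
  shows "mono_option (\<lambda>f. prog_bind (m f) (k f) \<sigma>)"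
  unfolding prog_bind_def
proof (rule bind_mono)
  show "mono_option (\<lambda>f. case z of (out, \<sigma>') \<Rightarrow>
      case out of Returned q \<Rightarrow> k f q \<sigma>' | WrongAssumption \<Rightarrow> Some (WrongAssumption, \<sigma>'))" for z
    using assms(2) by (cases z; cases "fst z") (auto intro: option.const_mono)
qed (rule assms(1))

lemma const_prog_mono: "mono_option (\<lambda>f. c \<sigma>)"
  by (rule option.const_mono)

lemma if_prog_mono:
  assumes "mono_option (\<lambda>f. m f \<sigma>)" "mono_option (\<lambda>f. k f \<sigma>)"
  shows "mono_option (\<lambda>f. (if c then m f else k f) \<sigma>)"
  using assms by (cases c) auto

lemma select_mono:
  assumes "\<And>x \<sigma>. mono_option (\<lambda>f. b f x \<sigma>)"
  shows "mono_option (\<lambda>f. select (b f) xs \<sigma>)"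
proof (induction xs arbitrary: \<sigma>)
  case Nil
  show ?case by (simp add: const_prog_mono)
next
  case (Cons x xs)
  show ?case
    unfolding select.simps
    by (intro prog_bind_mono assms Cons.IH const_prog_mono)
qed

lemma Close_mono:
  assumes "\<And>u v \<sigma>. mono_option (\<lambda>f. m f u v \<sigma>)"
  shows "mono_option (\<lambda>f. Close (m f) u v \<sigma>)"
  unfolding Close_def by (intro prog_bind_mono if_prog_mono const_prog_mono assms)

lemma MatchDistribution_mono:
  assumes "\<And>u v \<sigma>. mono_option (\<lambda>f. m f u v \<sigma>)"
  shows "mono_option (\<lambda>f. MatchDistribution P sc (m f) \<Delta> \<Theta> \<sigma>)"
  unfolding MatchDistribution_def
  by (intro prog_bind_mono select_mono const_prog_mono)
    (use Close_mono[of m] assms in \<open>auto split: prod.split\<close>)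

lemma MatchAction_mono:
  assumes "\<And>u v \<sigma>. mono_option (\<lambda>f. m f u v \<sigma>)"
  shows "mono_option (\<lambda>f. MatchAction P sc (m f) s t a \<sigma>)"
  unfolding MatchAction_def
  by (intro prog_bind_mono select_mono const_prog_mono)
    (use MatchDistribution_mono[of m] assms in \<open>auto split: prod.split\<close>)

lemma Match_body_mono [partial_function_mono]:
  assumes "\<And>u v \<sigma>. mono_option (\<lambda>f. m f u v \<sigma>)"
  shows "mono_option (\<lambda>f. Match_body P sc (m f) s t \<sigma>)"
  unfolding Match_body_def Let_def
  by (intro prog_bind_mono select_mono MatchAction_mono if_prog_mono const_prog_mono assms)

partial_function (option) Match ::
  "('s, 'a) plts \<Rightarrow> ('s, 'a) schedule \<Rightarrow> 's \<Rightarrow> 's \<Rightarrow> 's store \<Rightarrow> (bool outcome \<times> 's store) option" where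
  "Match P sc s t \<sigma> = Match_body P sc (\<lambda>u v \<sigma>. Match P sc u v \<sigma>) s t \<sigma>"

text \<open>One attempt, in which the exception is not yet handled.\<close>

definition Bis_attempt ::
  "('s, 'a) plts \<Rightarrow> ('s, 'a) schedule \<Rightarrow> 's \<Rightarrow> 's \<Rightarrow> ('s, bool) prog" where
  "Bis_attempt P sc s t = do {
     modify (Visited_update (\<lambda>_. {}));
     modify (Assumed_update (\<lambda>_. {}));
     Match P sc s t
   }"

partial_function (option) Bis ::
  "('s, 'a) plts \<Rightarrow> ('s, 'a) schedule \<Rightarrow> 's \<Rightarrow> 's \<Rightarrow> 's store \<Rightarrow> bool option" where
  "Bis P sc s t \<sigma> = Option.bind (Bis_attempt P sc s t \<sigma>) (\<lambda>(out, \<sigma>').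
     case out of Returned b \<Rightarrow> Some b | WrongAssumption \<Rightarrow> Bis P sc s t \<sigma>')"

definition Bisim :: "('s, 'a) plts \<Rightarrow> ('s, 'a) schedule \<Rightarrow> 's \<Rightarrow> 's \<Rightarrow> bool option" where
  "Bisim P sc s t = Bis P sc s t \<lparr>NotBisim = {}, Visited = {}, Assumed = {}\<rparr>"

lemma enumerates_some: "finite X \<Longrightarrow> enumerates (SOME xs. enumerates xs X) X"
  by (rule someI_ex) (auto simp: enumerates_def dest: finite_distinct_list)

lemma ex_schedule:
  fixes P :: "('s, 'a) plts"
  assumes "finitary P"
  shows "\<exists>sc. is_schedule P sc"
proof -
  have fin: "finite (derivatives P s a)" if "s \<in> states P" for s a
  proof -
    have "derivatives P s a \<subseteq> snd ` {(a, \<Delta>). (s, a, \<Delta>) \<in> transitions P}"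
      by (force simp: derivatives_def)
    with assms that show ?thesis
      unfolding finitary_def by (blast intro: finite_subset finite_imageI)
  qed
  have fin': "finite (enabled P s t)" if "s \<in> states P" "t \<in> states P" for s t
  proof -
    have "enabled P s t \<subseteq> fst ` {(a, \<Delta>). (s, a, \<Delta>) \<in> transitions P} \<union>
                          fst ` {(a, \<Delta>). (t, a, \<Delta>) \<in> transitions P}"
      by (force simp: enabled_def derivatives_def)
    with assms that show ?thesis
      unfolding finitary_def by (blast intro: finite_subset finite_imageI finite_UnI)
  qed
  have "is_schedule P
    \<lparr>action_order = (\<lambda>\<sigma> s t. SOME xs. enumerates xs (enabled P s t)),
     transition_order = (\<lambda>\<sigma> s t a. SOME xs. enumerates xs (derivatives P s a \<times> derivatives P t a)),
     support_order = (\<lambda>\<sigma> \<Delta> \<Theta>. SOME xs. enumerates xs (set_pmf \<Delta> \<times> set_pmf \<Theta>))\<rparr>"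
    unfolding is_schedule_def
    by (simp add: enumerates_some fin fin' dists_def)
  then show ?thesis ..
qed

end

theory Submission
  imports Defs
begin

text \<open>
  Call a pair matched by a relation \<open>R\<close> if the two transfer conditions hold for it with respect to
  the lifting of \<open>R\<close>. As \<open>Close\<close> returns false only for pairs in \<open>NotBisim\<close>, and lifting is
  monotone, every pair that enters \<open>NotBisim\<close> fails to be matched by \<open>\<sim>\<close> and is thus not bisimilar.
  Conversely, when an attempt ends without exception, every visited pair outside \<open>NotBisim\<close> is
  matched by the relation consisting of all these pairs, which is therefore a bisimulation. An attempt
  terminates because each call of \<open>Match\<close> visits a new pair. The exception is raised only for an
  assumed pair, and a pair is assumed only while outside \<open>NotBisim\<close>; hence every failed attempt
  strictly enlarges \<open>NotBisim\<close>, and there are finitely many attempts.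
\<close>

section \<open>Liftings as couplings\<close>

lemma ex_pmf_of_weights:
  fixes w :: "'x \<Rightarrow> real"
  assumes "finite A" and "\<And>x. x \<in> A \<Longrightarrow> 0 \<le> w x" and "sum w A = 1"
  obtains q where "\<And>x. pmf q x = (if x \<in> A then w x else 0)"
proof -
  let ?w = "\<lambda>x. if x \<in> A then w x else 0"
  have "(\<integral>\<^sup>+x. ennreal (?w x) \<partial>count_space UNIV) = (\<Sum>x\<in>A. ennreal (w x))"
    using assms(1) by (subst nn_integral_count_space'[of A]) auto
  also have "\<dots> = ennreal (sum w A)"
    using assms(2) by (rule sum_ennreal)
  finally have "(\<integral>\<^sup>+x. ennreal (?w x) \<partial>count_space UNIV) = 1"
    using assms(3) by simp
  then have "pmf (embed_pmf ?w) x = ?w x" for x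
    using assms(2) by (intro pmf_embed_pmf) auto
  then show thesis by (rule that)
qed

lemma pmf_map_sum:
  assumes "finite A" and "set_pmf q \<subseteq> A"
  shows "pmf (map_pmf f q) y = (\<Sum>x\<in>{x \<in> A. f x = y}. pmf q x)"
proof -
  have "measure (measure_pmf q) (f -` {y}) = measure (measure_pmf q) {x \<in> A. f x = y}"
    using assms(2) by (intro measure_eq_AE) (auto simp: AE_measure_pmf_iff)
  with assms(1) show ?thesis
    by (simp add: pmf_map measure_measure_pmf_finite)
qed

lemma pmf_map_fst_sum:
  assumes "finite S" and "set_pmf q \<subseteq> S \<times> S"
  shows "pmf (map_pmf fst q) s = (if s \<in> S then \<Sum>t\<in>S. pmf q (s, t) else 0)"
proof -
  have "{x \<in> S \<times> S. fst x = s} = (if s \<in> S then Pair s ` S else {})" by auto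
  with assms(1) show ?thesis
    by (subst pmf_map_sum[OF _ assms(2)]) (auto simp: sum.reindex inj_on_def)
qed

lemma pmf_map_snd_sum:
  assumes "finite S" and "set_pmf q \<subseteq> S \<times> S"
  shows "pmf (map_pmf snd q) t = (if t \<in> S then \<Sum>s\<in>S. pmf q (s, t) else 0)"
proof -
  have "{x \<in> S \<times> S. snd x = t} = (if t \<in> S then (\<lambda>s. (s, t)) ` S else {})" by auto
  with assms(1) show ?thesis
    by (subst pmf_map_sum[OF _ assms(2)]) (auto simp: sum.reindex inj_on_def)
qed

text \<open>The weights form a distribution on indices, and both mixtures are binds over it. Drawing
  one common index for both sides and then coupling \<open>D i\<close> with \<open>T i\<close>
  couples the mixtures.\<close>

lemma rel_pmf_convex:
  assumes "\<And>i. i < (n::nat) \<Longrightarrow> rel_pmf Q (D i) (T i)"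
    and "\<And>i. i < n \<Longrightarrow> 0 \<le> p i" and "(\<Sum>i<n. p i) = (1::real)"
    and "\<And>x. pmf \<Delta> x = (\<Sum>i<n. p i * pmf (D i) x)"
    and "\<And>x. pmf \<Theta> x = (\<Sum>i<n. p i * pmf (T i) x)"
  shows "rel_pmf Q \<Delta> \<Theta>"
proof -
  obtain q where q: "\<And>i. pmf q i = (if i \<in> {..<n} then p i else 0)"
    using ex_pmf_of_weights[of "{..<n}" p] assms(2,3) by auto
  have supp: "set_pmf q \<subseteq> {..<n}"
    using q by (auto simp: set_pmf_iff split: if_splits)
  have mix: "pmf (bind_pmf q F) x = (\<Sum>i<n. p i * pmf (F i) x)" for F :: "nat \<Rightarrow> 'c pmf" and x
    unfolding pmf_bind
    by (subst integral_measure_pmf[of "{..<n}"]) (use supp q in \<open>auto intro!: sum.cong\<close>)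
  have "\<Delta> = bind_pmf q D" by (rule pmf_eqI) (simp add: mix assms(4))
  moreover have "\<Theta> = bind_pmf q T" by (rule pmf_eqI) (simp add: mix assms(5))
  moreover have "rel_pmf Q (bind_pmf q D) (bind_pmf q T)"
    by (rule rel_pmf_bindI[where R = "\<lambda>i j. i = j \<and> i < n"])
      (use supp assms(1) in \<open>auto intro!: rel_pmf_reflI\<close>)
  ultimately show ?thesis by simp
qed

text \<open>\<open>rel_pmf\<close> asks for a coupling supported in \<open>R\<close>. Such couplings
  exist for related points and survive mixing; conversely, a coupling with finite support is itself
  a finite convex combination of point pairs from \<open>R\<close>.\<close>

lemma lifting_iff_rel_pmf:
  assumes "finite (set_pmf \<Delta>)" and "finite (set_pmf \<Theta>)"
  shows "lifting R \<Delta> \<Theta> \<longleftrightarrow> rel_pmf (\<lambda>x y. (x, y) \<in> R) \<Delta> \<Theta>"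
proof
  assume "lifting R \<Delta> \<Theta>"
  then show "rel_pmf (\<lambda>x y. (x, y) \<in> R) \<Delta> \<Theta>"
  proof induction
    case (point s t)
    then show ?case by (simp add: rel_pmf_return_pmf1)
  next
    case (convex n D T p \<Delta> \<Theta>)
    show ?case
      by (rule rel_pmf_convex[where p = p, OF convex.IH]) (use convex.hyps in auto)
  qed
next
  assume "rel_pmf (\<lambda>x y. (x, y) \<in> R) \<Delta> \<Theta>"
  then obtain q where q: "\<And>x y. (x, y) \<in> set_pmf q \<Longrightarrow> (x, y) \<in> R"
    "map_pmf fst q = \<Delta>" "map_pmf snd q = \<Theta>"
    by (auto elim: rel_pmf.cases)
  have "set_pmf q \<subseteq> set_pmf \<Delta> \<times> set_pmf \<Theta>"
    using q(2,3) by force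
  then have fin: "finite (set_pmf q)"
    using assms finite_subset by blast
  \<comment> \<open>\<open>lifting.convex\<close> indexes its summands by an initial segment of the
    naturals, so the support of the coupling is enumerated by \<open>h\<close>, with weight
    \<open>pmf q (h i)\<close> at index \<open>i\<close>.\<close>
  then obtain h where h: "bij_betw h {0..<card (set_pmf q)} (set_pmf q)"
    using ex_bij_betw_nat_finite by blast
  let ?n = "card (set_pmf q)"
  have mem: "h i \<in> set_pmf q" if "i < ?n" for i
    using h that by (auto simp: bij_betw_def)
  have reindex: "(\<Sum>i<?n. g (h i)) = sum g (set_pmf q)" for g :: "_ \<Rightarrow> real"
    using sum.reindex_bij_betw[OF h, of g] by (simp add: atLeast0LessThan)
  have marg: "pmf (map_pmf f q) x = (\<Sum>i<?n. pmf q (h i) * pmf (return_pmf (f (h i))) x)"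
    for f :: "_ \<Rightarrow> 's" and x
    using fin unfolding reindex[of "\<lambda>z. pmf q z * pmf (return_pmf (f z)) x"]
    by (subst pmf_map_sum[of "set_pmf q"])
      (simp_all add: indicator_def sum.inter_filter sum.inter_restrict if_distrib eq_commute[of x] cong: if_cong)
  show "lifting R \<Delta> \<Theta>"
  proof (rule lifting.convex[where n = ?n and p = "\<lambda>i. pmf q (h i)"
        and D = "\<lambda>i. return_pmf (fst (h i))" and T = "\<lambda>i. return_pmf (snd (h i))"])
    show "lifting R (return_pmf (fst (h i))) (return_pmf (snd (h i)))" if "i < ?n" for i
      using mem[OF that] q(1) by (cases "h i") (auto intro: lifting.point)
    show "(\<Sum>i<?n. pmf q (h i)) = 1"
      using fin by (simp add: reindex[of "pmf q"] sum_pmf_eq_1)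
  qed (use marg[of fst] marg[of snd] q(2,3) in auto)
qed

text \<open>A coupling charges only pairs from the two supports. Hence nothing is lost when
  \<open>MatchDistribution\<close> tests these pairs alone.\<close>

lemma lifting_restrict_support:
  assumes "finite (set_pmf \<Delta>)" and "finite (set_pmf \<Theta>)" and "lifting R \<Delta> \<Theta>"
  shows "lifting (R \<inter> set_pmf \<Delta> \<times> set_pmf \<Theta>) \<Delta> \<Theta>"
proof -
  have "rel_pmf (\<lambda>x y. (x, y) \<in> R) \<Delta> \<Theta>"
    using assms by (simp add: lifting_iff_rel_pmf)
  then have "rel_pmf (\<lambda>x y. (x, y) \<in> R \<inter> set_pmf \<Delta> \<times> set_pmf \<Theta>) \<Delta> \<Theta>"
    by (rule pmf.rel_mono_strong) auto
  with assms show ?thesis by (simp add: lifting_iff_rel_pmf)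
qed

text \<open>Swap the coordinates of the coupling. This turns the simulation condition for the
  converse relation into a condition on \<open>R\<close> itself.\<close>

lemma lifting_converse:
  assumes "finite (set_pmf \<Delta>)" and "finite (set_pmf \<Theta>)"
  shows "lifting (R\<inverse>) \<Theta> \<Delta> \<longleftrightarrow> lifting R \<Delta> \<Theta>"
  using assms pmf.rel_flip[of "\<lambda>x y. (x, y) \<in> R" \<Theta> \<Delta>]
  by (simp add: lifting_iff_rel_pmf conversep_iff[abs_def])


section \<open>\<open>Check\<close> decides the lifting\<close>

lemma sum_nodes:
  assumes "finite S"
  shows "(\<Sum>v\<in>nodes S. g v) = g Source + g Sink + (\<Sum>s\<in>S. g (Orig s)) + (\<Sum>s\<in>S. g (Copy s))"
    (is "_ = ?r")
proof -
  have "(\<Sum>v\<in>nodes S. g v) = sum g {Source, Sink} + sum g (Orig ` S) + sum g (Copy ` S)"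
    unfolding nodes_def using assms
    by (subst sum.union_disjoint, simp, simp, force)+ simp
  also have "\<dots> = ?r"
    by (simp add: sum.reindex inj_on_def)
  finally show ?thesis .
qed

text \<open>Zero capacity together with nonnegativity forces zero flow, so every sum over all nodes
  collapses to the edges actually present in the network.\<close>

lemma flow_equations:
  assumes "finite S" and "is_flow (nodes S) Source Sink (capacity \<Delta> \<Theta> R) f"
  shows flow_value_eq: "flow_value (nodes S) Source f = (\<Sum>s\<in>S. f Source (Orig s))"
    and flow_source_le: "\<And>s. s \<in> S \<Longrightarrow> f Source (Orig s) \<le> pmf \<Delta> s"
    and flow_Orig: "\<And>s. s \<in> S \<Longrightarrow> f Source (Orig s) = (\<Sum>t\<in>S. f (Orig s) (Copy t))"
    and flow_Copy: "\<And>t. t \<in> S \<Longrightarrow> (\<Sum>s\<in>S. f (Orig s) (Copy t)) = f (Copy t) Sink"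
    and flow_sink_le: "\<And>t. t \<in> S \<Longrightarrow> f (Copy t) Sink \<le> pmf \<Theta> t"
proof -
  have bnd: "0 \<le> f u v" "f u v \<le> capacity \<Delta> \<Theta> R u v" if "u \<in> nodes S" "v \<in> nodes S" for u v
    using assms(2) that by (auto simp: is_flow_def)
  have zero: "f u v = 0" if "u \<in> nodes S" "v \<in> nodes S" "capacity \<Delta> \<Theta> R u v = 0" for u v
    using bnd[of u v] that by simp
  have N: "Source \<in> nodes S" "Sink \<in> nodes S" "\<And>s. s \<in> S \<Longrightarrow> Orig s \<in> nodes S"
    "\<And>s. s \<in> S \<Longrightarrow> Copy s \<in> nodes S"
    by (auto simp: nodes_def)
  have cons: "(\<Sum>u\<in>nodes S. f u v) = (\<Sum>u\<in>nodes S. f v u)" if "v \<in> {Orig s, Copy s}" "s \<in> S" for s v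
    using assms(2) that N unfolding is_flow_def by blast
  show "flow_value (nodes S) Source f = (\<Sum>s\<in>S. f Source (Orig s))"
    unfolding flow_value_def using assms(1) N by (simp add: sum_nodes zero)
  show "f Source (Orig s) \<le> pmf \<Delta> s" if "s \<in> S" for s
    using bnd[of Source "Orig s"] N that by simp
  show "f Source (Orig s) = (\<Sum>t\<in>S. f (Orig s) (Copy t))" if "s \<in> S" for s
    using cons[of "Orig s" s] assms N that by (simp add: sum_nodes zero)
  show "(\<Sum>s\<in>S. f (Orig s) (Copy t)) = f (Copy t) Sink" if "t \<in> S" for t
    using cons[of "Copy t" t] assms N that by (simp add: sum_nodes zero)
  show "f (Copy t) Sink \<le> pmf \<Theta> t" if "t \<in> S" for t
    using bnd[of "Copy t" Sink] N that by simp
qed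

text \<open>Equal totals leave no slack in any term. This is how a flow of value 1 is seen to
  saturate every edge at the source and at the sink.\<close>

lemma sum_eq_imp_eq:
  fixes g h :: "'x \<Rightarrow> real"
  assumes "finite A" and "\<And>x. x \<in> A \<Longrightarrow> g x \<le> h x" and "sum g A = sum h A" and "x \<in> A"
  shows "g x = h x"
proof -
  have "(\<Sum>x\<in>A. h x - g x) = 0" using assms(3) by (simp add: sum_subtractf)
  with assms show ?thesis by (subst (asm) sum_nonneg_eq_0_iff) auto
qed

text \<open>The flow through the middle edges is the coupling. Its value equals the total capacity
  at the source and at the sink, so the outer edges are saturated, and conservation then makes the
  row and column sums the two given distributions.\<close>

lemma rel_pmf_of_unit_flow:
  assumes "finite S" and "set_pmf \<Delta> \<subseteq> S" and "set_pmf \<Theta> \<subseteq> S"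
    and flow: "is_flow (nodes S) Source Sink (capacity \<Delta> \<Theta> R) f"
    and "flow_value (nodes S) Source f = 1"
  shows "rel_pmf (\<lambda>x y. (x, y) \<in> R) \<Delta> \<Theta>"
proof -
  define w where "w = (\<lambda>(s, t). f (Orig s) (Copy t))"
  have bnd: "0 \<le> w (s, t)" "w (s, t) \<le> (if (s, t) \<in> R then 1 else 0)" if "s \<in> S" "t \<in> S" for s t
  proof -
    have "Orig s \<in> nodes S" "Copy t \<in> nodes S" using that by (auto simp: nodes_def)
    with flow have "0 \<le> f (Orig s) (Copy t) \<and> f (Orig s) (Copy t) \<le> capacity \<Delta> \<Theta> R (Orig s) (Copy t)"
      unfolding is_flow_def by blast
    then show "0 \<le> w (s, t)" "w (s, t) \<le> (if (s, t) \<in> R then 1 else 0)"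
      by (auto simp: w_def)
  qed
  have "f Source (Orig s) = pmf \<Delta> s" if "s \<in> S" for s
    using assms flow_value_eq[OF assms(1) flow] flow_source_le[OF assms(1) flow] that
    by (intro sum_eq_imp_eq[of S "\<lambda>s. f Source (Orig s)"]) (auto simp: sum_pmf_eq_1)
  then have row: "(\<Sum>t\<in>S. w (s, t)) = pmf \<Delta> s" if "s \<in> S" for s
    using flow_Orig[OF assms(1) flow that] that by (simp add: w_def)
  then have total: "(\<Sum>s\<in>S. \<Sum>t\<in>S. w (s, t)) = 1"
    using assms by (simp add: sum_pmf_eq_1)
  have col: "(\<Sum>s\<in>S. w (s, t)) = pmf \<Theta> t" if "t \<in> S" for t
  proof (rule sum_eq_imp_eq[of S "\<lambda>t. \<Sum>s\<in>S. w (s, t)"])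
    show "(\<Sum>s\<in>S. w (s, t)) \<le> pmf \<Theta> t" if "t \<in> S" for t
      using flow_Copy[OF assms(1) flow that] flow_sink_le[OF assms(1) flow that] by (simp add: w_def)
    show "(\<Sum>t\<in>S. \<Sum>s\<in>S. w (s, t)) = sum (pmf \<Theta>) S"
      using total assms by (subst sum.swap) (simp add: sum_pmf_eq_1)
  qed (use assms that in auto)
  obtain q where q: "\<And>z. pmf q z = (if z \<in> S \<times> S then w z else 0)"
  proof (rule ex_pmf_of_weights[of "S \<times> S" w])
    show "sum w (S \<times> S) = 1"
      using total sum.cartesian_product[of "\<lambda>s t. w (s, t)" S S] by simp
  qed (use assms bnd in auto)
  have supp: "set_pmf q \<subseteq> S \<times> S" using q by (auto simp: set_pmf_iff split: if_splits)
  have "map_pmf fst q = \<Delta>"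
    using assms(1,2) by (intro pmf_eqI) (auto simp: pmf_map_fst_sum[OF _ supp] q row set_pmf_iff)
  moreover have "map_pmf snd q = \<Theta>"
    using assms(1,3) by (intro pmf_eqI) (auto simp: pmf_map_snd_sum[OF _ supp] q col set_pmf_iff)
  \<comment> \<open>A middle edge outside \<open>R\<close> has capacity 0 and thus gets weight
    0.\<close>
  moreover have "(s, t) \<in> R" if "(s, t) \<in> set_pmf q" for s t
    using that q[of "(s, t)"] bnd[of s t] by (auto simp: set_pmf_iff split: if_splits)
  ultimately show ?thesis by (intro rel_pmf.intros[of q]) auto
qed

fun coupling_flow :: "('s \<times> 's) pmf \<Rightarrow> 's node \<Rightarrow> 's node \<Rightarrow> real" where
  "coupling_flow q Source (Orig s) = pmf (map_pmf fst q) s"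
| "coupling_flow q (Copy t) Sink = pmf (map_pmf snd q) t"
| "coupling_flow q (Orig s) (Copy t) = pmf q (s, t)"
| "coupling_flow q _ _ = 0"

text \<open>Capacity 1 on a middle edge never restricts a probability, and pairs outside
  \<open>R\<close> carry none, so the coupling is a feasible flow. It is maximal because it
  saturates all edges leaving the source.\<close>

lemma Check_of_coupling:
  assumes "finite (states P)" and "set_pmf q \<subseteq> states P \<times> states P" and "set_pmf q \<subseteq> R"
  shows "Check P (map_pmf fst q) (map_pmf snd q) R"
proof -
  let ?S = "states P" and ?c = "capacity (map_pmf fst q) (map_pmf snd q) R" and ?f = "coupling_flow q"
  have cap: "0 \<le> ?f u v \<and> ?f u v \<le> ?c u v" for u v
    using assms(3) by (cases u; cases v) (auto simp: pmf_le_1 set_pmf_iff)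
  have "is_flow (nodes ?S) Source Sink ?c ?f"
    unfolding is_flow_def
  proof (intro conjI ballI)
    fix v assume "v \<in> nodes ?S - {Source, Sink}"
    then consider s where "v = Orig s" "s \<in> ?S" | t where "v = Copy t" "t \<in> ?S"
      by (auto simp: nodes_def)
    then show "(\<Sum>u\<in>nodes ?S. ?f u v) = (\<Sum>u\<in>nodes ?S. ?f v u)"
      by cases (simp_all add: sum_nodes[OF assms(1)] pmf_map_fst_sum[OF assms(1,2)]
        pmf_map_snd_sum[OF assms(1,2)])
  qed (use cap in blast)+
  moreover have dom: "set_pmf (map_pmf fst q) \<subseteq> ?S"
    using assms(2) by auto
  moreover have "flow_value (nodes ?S) Source ?f = 1"
    using flow_value_eq[OF assms(1) \<open>is_flow _ _ _ _ _\<close>] sum_pmf_eq_1[OF assms(1) dom] by simp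
  \<comment> \<open>The source edges form a cut whose capacity is the mass of the first
    marginal.\<close>
  moreover have "flow_value (nodes ?S) Source g \<le> 1" if "is_flow (nodes ?S) Source Sink ?c g" for g
    using sum_mono[of ?S "\<lambda>s. g Source (Orig s)" "pmf (map_pmf fst q)"]
      flow_value_eq[OF assms(1) that] flow_source_le[OF assms(1) that] sum_pmf_eq_1[OF assms(1) dom] by simp
  ultimately show ?thesis
    unfolding Check_def is_max_flow_def by (intro exI[of _ ?f]) simp
qed

lemma Check_iff_lifting:
  assumes "finite (states P)" and "\<Delta> \<in> dists (states P)" and "\<Theta> \<in> dists (states P)"
  shows "Check P \<Delta> \<Theta> R \<longleftrightarrow> lifting R \<Delta> \<Theta>"
proof
  assume "Check P \<Delta> \<Theta> R"
  then obtain f where "is_flow (nodes (states P)) Source Sink (capacity \<Delta> \<Theta> R) f"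
    "flow_value (nodes (states P)) Source f = 1"
    by (auto simp: Check_def is_max_flow_def)
  with assms show "lifting R \<Delta> \<Theta>"
    by (auto simp: dists_def lifting_iff_rel_pmf intro: rel_pmf_of_unit_flow)
next
  assume "lifting R \<Delta> \<Theta>"
  with assms have "rel_pmf (\<lambda>x y. (x, y) \<in> R) \<Delta> \<Theta>"
    by (simp add: dists_def lifting_iff_rel_pmf)
  then obtain q where q: "\<And>x y. (x, y) \<in> set_pmf q \<Longrightarrow> (x, y) \<in> R"
    "map_pmf fst q = \<Delta>" "map_pmf snd q = \<Theta>"
    by (auto elim: rel_pmf.cases)
  then have "set_pmf q \<subseteq> set_pmf \<Delta> \<times> set_pmf \<Theta>" by force
  with assms have "set_pmf q \<subseteq> states P \<times> states P"
    by (auto simp: dists_def)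
  moreover have "set_pmf q \<subseteq> R" using q(1) by auto
  ultimately show "Check P \<Delta> \<Theta> R"
    using assms(1) q(2,3) Check_of_coupling by blast
qed

section \<open>Total correctness with an exceptional postcondition\<close>

text \<open>Since \<open>None\<close> meets no postcondition, every \<open>wp\<close> statement
  includes termination. The separate \<open>E\<close> describes stores left by an exception, for
  which the ordinary invariant need not hold.\<close>

definition wp ::
  "('s, 'r) prog \<Rightarrow> ('r \<Rightarrow> 's store \<Rightarrow> bool) \<Rightarrow> ('s store \<Rightarrow> bool) \<Rightarrow> 's store \<Rightarrow> bool" where
  "wp m Q E \<sigma> \<longleftrightarrow> (case m \<sigma> of None \<Rightarrow> False
     | Some (Returned r, \<sigma>') \<Rightarrow> Q r \<sigma>' | Some (WrongAssumption, \<sigma>') \<Rightarrow> E \<sigma>')"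

lemma wp_ret [simp]: "wp (ret r) Q E \<sigma> \<longleftrightarrow> Q r \<sigma>"
  and wp_raise_wrong [simp]: "wp raise_wrong Q E \<sigma> \<longleftrightarrow> E \<sigma>"
  and wp_get [simp]: "wp get Q' E \<sigma> \<longleftrightarrow> Q' \<sigma> \<sigma>"
  and wp_modify [simp]: "wp (modify h) Q'' E \<sigma> \<longleftrightarrow> Q'' () (h \<sigma>)"
  by (simp_all add: wp_def ret_def raise_wrong_def get_def modify_def)

lemma wp_bind [simp]: "wp (prog_bind m k) Q E \<sigma> \<longleftrightarrow> wp m (\<lambda>q. wp (k q) Q E) E \<sigma>"
  by (auto simp: wp_def prog_bind_def split: option.splits outcome.splits)

lemma wp_mono:
  assumes "wp m Q E \<sigma>" and "\<And>r \<sigma>'. Q r \<sigma>' \<Longrightarrow> Q' r \<sigma>'"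
  shows "wp m Q' E \<sigma>"
  using assms by (auto simp: wp_def split: option.splits outcome.splits)

text \<open>Loop rule. A positive result \<open>T\<close> may depend on the store and must therefore
  survive the later iterations, whose effect is bounded by \<open>R\<close>; a negative result
  \<open>F\<close> is a fact independent of the store.\<close>

lemma wp_select:
  assumes step: "\<And>x \<sigma>. x \<in> set xs \<Longrightarrow> R \<sigma>\<^sub>0 \<sigma> \<Longrightarrow>
      wp (b x) (\<lambda>r \<sigma>'. R \<sigma> \<sigma>' \<and> (if r then T x \<sigma>' else F x)) E \<sigma>"
    and stable: "\<And>x \<sigma> \<sigma>'. R \<sigma> \<sigma>' \<Longrightarrow> T x \<sigma> \<Longrightarrow> T x \<sigma>'"
    and trans: "\<And>\<sigma> \<sigma>' \<sigma>''. R \<sigma> \<sigma>' \<Longrightarrow> R \<sigma>' \<sigma>'' \<Longrightarrow> R \<sigma> \<sigma>''"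
    and refl: "\<And>\<sigma> \<sigma>'. R \<sigma> \<sigma>' \<Longrightarrow> R \<sigma>' \<sigma>'"
    and init: "R \<sigma>\<^sub>0 \<sigma>\<^sub>0"
  shows "wp (select b xs)
    (\<lambda>X \<sigma>'. R \<sigma>\<^sub>0 \<sigma>' \<and> X \<subseteq> set xs \<and> (\<forall>x\<in>X. T x \<sigma>') \<and> (\<forall>x\<in>set xs - X. F x)) E \<sigma>\<^sub>0"
proof -
  \<comment> \<open>The induction runs over the remaining entries, from any store reachable by
    \<open>R\<close> from the initial one.\<close>
  have "wp (select b ys)
    (\<lambda>X \<sigma>'. R \<sigma> \<sigma>' \<and> X \<subseteq> set ys \<and> (\<forall>x\<in>X. T x \<sigma>') \<and> (\<forall>x\<in>set ys - X. F x)) E \<sigma>"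
    if "set ys \<subseteq> set xs" "R \<sigma>\<^sub>0 \<sigma>" for ys \<sigma>
    using that
  proof (induction ys arbitrary: \<sigma>)
    case Nil
    with refl show ?case by auto
  next
    case (Cons x ys)
    have "wp (b x) (\<lambda>r \<sigma>'. R \<sigma> \<sigma>' \<and> (if r then T x \<sigma>' else F x)) E \<sigma>"
      using Cons.prems by (intro step) auto
    then show ?case
      unfolding select.simps wp_bind wp_ret
    proof (rule wp_mono)
      fix r \<sigma>\<^sub>1 assume r: "R \<sigma> \<sigma>\<^sub>1 \<and> (if r then T x \<sigma>\<^sub>1 else F x)"
      then have "R \<sigma>\<^sub>0 \<sigma>\<^sub>1" using Cons.prems trans by blast
      with Cons have "wp (select b ys)
        (\<lambda>X \<sigma>'. R \<sigma>\<^sub>1 \<sigma>' \<and> X \<subseteq> set ys \<and> (\<forall>x\<in>X. T x \<sigma>') \<and> (\<forall>x\<in>set ys - X. F x)) E \<sigma>\<^sub>1"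
        by simp
      then show "wp (select b ys) (\<lambda>X \<sigma>'. R \<sigma> \<sigma>' \<and> (if r then insert x X else X) \<subseteq> set (x # ys) \<and>
          (\<forall>y\<in>if r then insert x X else X. T y \<sigma>') \<and>
          (\<forall>y\<in>set (x # ys) - (if r then insert x X else X). F y)) E \<sigma>\<^sub>1"
      proof (rule wp_mono)
        fix X \<sigma>\<^sub>2
        assume "R \<sigma>\<^sub>1 \<sigma>\<^sub>2 \<and> X \<subseteq> set ys \<and> (\<forall>y\<in>X. T y \<sigma>\<^sub>2) \<and> (\<forall>y\<in>set ys - X. F y)"
        moreover from this r have "R \<sigma> \<sigma>\<^sub>2" using trans by blast
        moreover from calculation r have "r \<longrightarrow> T x \<sigma>\<^sub>2" using stable by meson
        ultimately show "R \<sigma> \<sigma>\<^sub>2 \<and> (if r then insert x X else X) \<subseteq> set (x # ys) \<and>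
            (\<forall>y\<in>if r then insert x X else X. T y \<sigma>\<^sub>2) \<and>
            (\<forall>y\<in>set (x # ys) - (if r then insert x X else X). F y)"
          using r by (cases r) auto
      qed
    qed
  qed
  with init show ?thesis by blast
qed

section \<open>The invariant of the algorithm\<close>

locale scheduled_plts =
  fixes P :: "('s, 'a) plts" and sc :: "('s, 'a) schedule"
  assumes plts: "is_plts P" and finitary: "finitary P" and schedule: "is_schedule P sc"
begin

abbreviation S :: "'s set" where "S \<equiv> states P"

section \<open>Bisimulations as relations that match all their pairs\<close>

definition action_matched :: "('s \<times> 's) set \<Rightarrow> 's \<Rightarrow> 's \<Rightarrow> 'a \<Rightarrow> bool" where
  "action_matched R s t a \<longleftrightarrow>
     (\<forall>\<Delta>\<in>derivatives P s a. \<exists>\<Theta>\<in>derivatives P t a. lifting R \<Delta> \<Theta>) \<and>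
     (\<forall>\<Theta>\<in>derivatives P t a. \<exists>\<Delta>\<in>derivatives P s a. lifting R \<Delta> \<Theta>)"

definition matched :: "('s \<times> 's) set \<Rightarrow> 's \<times> 's \<Rightarrow> bool" where
  "matched R = (\<lambda>(s, t). \<forall>a\<in>enabled P s t. action_matched R s t a)"

lemma finite_states: "finite S"
  using finitary by (simp add: finitary_def)

lemma derivatives_dists: "\<Delta> \<in> derivatives P s a \<Longrightarrow> \<Delta> \<in> dists S"
  using plts by (auto simp: is_plts_def derivatives_def)

lemma dists_finite: "\<Delta> \<in> dists S \<Longrightarrow> finite (set_pmf \<Delta>)"
  by (simp add: dists_def)

lemma action_matched_mono: "action_matched R s t a \<Longrightarrow> R \<subseteq> R' \<Longrightarrow> action_matched R' s t a"
  unfolding action_matched_def by (meson lifting_mono)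

lemma matched_mono: "matched R p \<Longrightarrow> R \<subseteq> R' \<Longrightarrow> matched R' p"
  by (auto simp: matched_def intro: action_matched_mono)

lemma lifting_converse_derivatives:
  "\<Delta> \<in> derivatives P s a \<Longrightarrow> \<Theta> \<in> derivatives P t a \<Longrightarrow> lifting (R\<inverse>) \<Theta> \<Delta> \<longleftrightarrow> lifting R \<Delta> \<Theta>"
  by (intro lifting_converse dists_finite derivatives_dists)

text \<open>An action outside \<open>enabled P s t\<close> labels no transition of \<open>s\<close>
  or \<open>t\<close>, so its transfer conditions are vacuous. Converting the lifting of the
  converse lets both conditions speak of the same \<open>R\<close>.\<close>

lemma prob_bisimulation_iff_matched:
  "prob_bisimulation P R \<longleftrightarrow> R \<subseteq> S \<times> S \<and> (\<forall>p\<in>R. matched R p)"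
proof -
  have enabled: "(\<forall>a\<in>enabled P s t. action_matched R s t a) \<longleftrightarrow> (\<forall>a. action_matched R s t a)" for s t
  proof -
    have "action_matched R s t a" if "a \<notin> enabled P s t" for a
      using that plts by (auto simp: action_matched_def enabled_def is_plts_def derivatives_def)
    then show ?thesis by blast
  qed
  have "simulates P R \<longleftrightarrow>
      (\<forall>(s, t)\<in>R. \<forall>a. \<forall>\<Delta>\<in>derivatives P s a. \<exists>\<Theta>\<in>derivatives P t a. lifting R \<Delta> \<Theta>)"
    unfolding simulates_def derivatives_def by fastforce
  moreover have "simulates P (R\<inverse>) \<longleftrightarrow>
      (\<forall>(s, t)\<in>R. \<forall>a. \<forall>\<Theta>\<in>derivatives P t a. \<exists>\<Delta>\<in>derivatives P s a. lifting (R\<inverse>) \<Theta> \<Delta>)"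
    unfolding simulates_def derivatives_def by fastforce
  moreover have "\<dots> \<longleftrightarrow>
      (\<forall>(s, t)\<in>R. \<forall>a. \<forall>\<Theta>\<in>derivatives P t a. \<exists>\<Delta>\<in>derivatives P s a. lifting R \<Delta> \<Theta>)"
    using lifting_converse_derivatives[of _ _ _ _ _ R] by auto
  ultimately show ?thesis
    unfolding prob_bisimulation_def matched_def enabled action_matched_def by blast
qed

lemma bisimilar_matched: "p \<in> bisimilarity P \<Longrightarrow> matched (bisimilarity P) p"
  using bisimilarity_largest(1)[of P] by (simp add: prob_bisimulation_iff_matched)

lemma bisimilarI: "R \<subseteq> S \<times> S \<Longrightarrow> (\<And>p. p \<in> R \<Longrightarrow> matched R p) \<Longrightarrow> p \<in> R \<Longrightarrow> p \<in> bisimilarity P"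
  using bisimilarity_largest(2)[of P R] by (auto simp: prob_bisimulation_iff_matched)

text \<open>
  \<open>I\<close> is the set of pairs whose call of \<open>Match\<close> is still in progress. Among them only the assumed
  ones can be relied upon: if one of those fails later, the exception discards the whole attempt.
  An in-progress pair that nobody has assumed can fail without invalidating anything, which is why
  it must not be trusted.
\<close>

definition trusted :: "('s \<times> 's) set \<Rightarrow> 's store \<Rightarrow> ('s \<times> 's) set" where
  "trusted I \<sigma> = Assumed \<sigma> \<union> (Visited \<sigma> - I - NotBisim \<sigma>)"

text \<open>\<open>N\<close> is the value of \<open>NotBisim\<close> at the start of the attempt.\<close>

definition consistent :: "('s \<times> 's) set \<Rightarrow> ('s \<times> 's) set \<Rightarrow> 's store \<Rightarrow> bool" where
  "consistent N I \<sigma> \<longleftrightarrow> Visited \<sigma> \<subseteq> S \<times> S \<and> Assumed \<sigma> \<subseteq> Visited \<sigma> - NotBisim \<sigma> \<and> I \<subseteq> Visited \<sigma> \<and>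
     N \<subseteq> NotBisim \<sigma> \<and> NotBisim \<sigma> \<subseteq> S \<times> S - bisimilarity P \<and>
     (\<forall>p\<in>Visited \<sigma> - I - NotBisim \<sigma>. matched (trusted I \<sigma>) p)"

text \<open>The last conjunct says that no pair visited before gets newly refuted:
  \<open>Match\<close> refutes only its own pair, and inner calls concern unvisited pairs. This
  keeps \<open>trusted\<close> growing, so earlier positive answers stay valid.\<close>

definition advances :: "('s \<times> 's) set \<Rightarrow> ('s \<times> 's) set \<Rightarrow> 's store \<Rightarrow> 's store \<Rightarrow> bool" where
  "advances N I \<sigma> \<sigma>' \<longleftrightarrow> consistent N I \<sigma>' \<and> Visited \<sigma> \<subseteq> Visited \<sigma>' \<and> NotBisim \<sigma> \<subseteq> NotBisim \<sigma>' \<and>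
     Assumed \<sigma> \<subseteq> Assumed \<sigma>' \<and> NotBisim \<sigma>' \<inter> Visited \<sigma> \<subseteq> NotBisim \<sigma>"

text \<open>What an exception guarantees: strict growth bounds the number of restarts, and the
  second conjunct is the precondition of the next round.\<close>

definition refuted_more :: "('s \<times> 's) set \<Rightarrow> 's store \<Rightarrow> bool" where
  "refuted_more N \<sigma> \<longleftrightarrow> N \<subset> NotBisim \<sigma> \<and> NotBisim \<sigma> \<subseteq> S \<times> S - bisimilarity P"

lemma adv_refl: "consistent N I \<sigma> \<Longrightarrow> advances N I \<sigma> \<sigma>"
  by (simp add: advances_def)

lemma adv_trans: "advances N I \<sigma> \<sigma>' \<Longrightarrow> advances N I \<sigma>' \<sigma>'' \<Longrightarrow> advances N I \<sigma> \<sigma>''"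
  unfolding advances_def by blast

lemma trusted_mono: "advances N I \<sigma> \<sigma>' \<Longrightarrow> trusted I \<sigma> \<subseteq> trusted I \<sigma>'"
  unfolding advances_def trusted_def by blast

section \<open>Partial answers of the mutually recursive procedures\<close>

lemma wp_select_adv:
  assumes inv: "consistent N I \<sigma>\<^sub>0"
    and mono: "\<And>x W W'. U x W \<Longrightarrow> W \<subseteq> W' \<Longrightarrow> U x W'"
    and step: "\<And>x \<sigma>. x \<in> set xs \<Longrightarrow> advances N I \<sigma>\<^sub>0 \<sigma> \<Longrightarrow> consistent N I \<sigma> \<Longrightarrow>
      wp (b x) (\<lambda>r \<sigma>'. advances N I \<sigma> \<sigma>' \<and> (if r then U x (trusted I \<sigma>') else F x)) E \<sigma>"
  shows "wp (select b xs) (\<lambda>X \<sigma>'. advances N I \<sigma>\<^sub>0 \<sigma>' \<and> X \<subseteq> set xs \<and>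
    (\<forall>x\<in>X. U x (trusted I \<sigma>')) \<and> (\<forall>x\<in>set xs - X. F x)) E \<sigma>\<^sub>0"
proof (rule wp_select)
  show "advances N I \<sigma>\<^sub>0 \<sigma>\<^sub>0" using inv by (rule adv_refl)
  show "advances N I \<sigma>' \<sigma>'" if "advances N I \<sigma> \<sigma>'" for \<sigma> \<sigma>'
    using that by (simp add: advances_def)
  show "U x (trusted I \<sigma>')" if "advances N I \<sigma> \<sigma>'" "U x (trusted I \<sigma>)" for x \<sigma> \<sigma>'
    using that(2) trusted_mono[OF that(1)] by (rule mono)
  show "wp (b x) (\<lambda>r \<sigma>'. advances N I \<sigma> \<sigma>' \<and> (if r then U x (trusted I \<sigma>') else F x)) E \<sigma>"
    if "x \<in> set xs" "advances N I \<sigma>\<^sub>0 \<sigma>" for x \<sigma>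
    using that by (intro step) (simp_all add: advances_def)
qed (rule adv_trans)

text \<open>A positive answer is relative to the trusted pairs, a negative one is absolute, because
  \<open>consistent\<close> keeps bisimilar pairs out of \<open>NotBisim\<close>. The implication in
  the positive case yields \<open>(s, t)\<close> outside \<open>NotBisim\<close> whenever the caller
  has checked this beforehand, as \<open>Close\<close> does.\<close>

definition Match_correct ::
  "('s \<times> 's) set \<Rightarrow> ('s \<times> 's) set \<Rightarrow> ('s \<Rightarrow> 's \<Rightarrow> ('s, bool) prog) \<Rightarrow>
   's \<Rightarrow> 's \<Rightarrow> 's store \<Rightarrow> bool" where
  "Match_correct N I m s t \<sigma> \<longleftrightarrow>
     wp (m s t) (\<lambda>b \<sigma>'. advances N I \<sigma> \<sigma>' \<and> (s, t) \<in> Visited \<sigma>' \<and>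
        (if b then matched (trusted I \<sigma>') (s, t) \<and> ((s, t) \<in> NotBisim \<sigma>' \<longrightarrow> (s, t) \<in> NotBisim \<sigma>)
         else (s, t) \<in> NotBisim \<sigma>'))
       (refuted_more N) \<sigma>"

lemma wp_Close:
  assumes "consistent N I \<sigma>" and "(u, v) \<notin> Visited \<sigma> \<Longrightarrow> Match_correct N I m u v \<sigma>"
  shows "wp (Close m u v)
    (\<lambda>r \<sigma>'. advances N I \<sigma> \<sigma>' \<and> (if r then (u, v) \<in> trusted I \<sigma>' else (u, v) \<notin> bisimilarity P))
    (refuted_more N) \<sigma>"
proof -
  consider "(u, v) \<in> NotBisim \<sigma>" | "(u, v) \<notin> NotBisim \<sigma>" "(u, v) \<in> Visited \<sigma>"
    | "(u, v) \<notin> NotBisim \<sigma>" "(u, v) \<notin> Visited \<sigma>" by blast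
  then show ?thesis
  proof cases
    case 1
    with assms(1) show ?thesis
      by (auto simp: Close_def adv_refl consistent_def)
  next
    case 2
    let ?\<sigma> = "Assumed_update (insert (u, v)) \<sigma>"
    \<comment> \<open>A new assumption only enlarges the trusted set, so all pairs matched so far
      remain matched.\<close>
    have "trusted I \<sigma> \<subseteq> trusted I ?\<sigma>" by (auto simp: trusted_def)
    with 2 assms(1) have "advances N I \<sigma> ?\<sigma>"
      by (auto simp: advances_def consistent_def intro: matched_mono)
    with 2 show ?thesis by (simp add: Close_def trusted_def)
  next
    case 3
    \<comment> \<open>After a positive answer the pair counts as trusted: it is visited, outside
      \<open>NotBisim\<close>, and not in progress, because \<open>I\<close> lies within
      \<open>Visited \<sigma>\<close> and the pair does not.\<close>
    show ?thesis
      unfolding Close_def wp_bind wp_get using 3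
      by simp (rule wp_mono[OF assms(2)[unfolded Match_correct_def]],
        use assms(1) in \<open>auto simp: trusted_def consistent_def advances_def split: if_splits\<close>)
  qed
qed

text \<open>The computed relation is sandwiched: it contains every bisimilar pair of the supports
  and consists of trusted pairs. Monotonicity of lifting gives one bound for each answer of
  \<open>Check\<close>.\<close>

lemma wp_MatchDistribution:
  assumes "consistent N I \<sigma>\<^sub>0" and "\<Delta> \<in> dists S" and "\<Theta> \<in> dists S"
    and Match: "\<And>u v \<sigma>. advances N I \<sigma>\<^sub>0 \<sigma> \<Longrightarrow> u \<in> S \<Longrightarrow> v \<in> S \<Longrightarrow> (u, v) \<notin> Visited \<sigma> \<Longrightarrow>
      Match_correct N I m u v \<sigma>"
  shows "wp (MatchDistribution P sc m \<Delta> \<Theta>)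
    (\<lambda>r \<sigma>'. advances N I \<sigma>\<^sub>0 \<sigma>' \<and>
       (if r then lifting (trusted I \<sigma>') \<Delta> \<Theta> else \<not> lifting (bisimilarity P) \<Delta> \<Theta>))
    (refuted_more N) \<sigma>\<^sub>0"
proof -
  have ord: "set (support_order sc \<sigma>\<^sub>0 \<Delta> \<Theta>) = set_pmf \<Delta> \<times> set_pmf \<Theta>"
    using schedule assms(2,3) by (simp add: is_schedule_def enumerates_def)
  have supp: "set_pmf \<Delta> \<times> set_pmf \<Theta> \<subseteq> S \<times> S"
    using assms(2,3) by (auto simp: dists_def)
  have "wp (select (\<lambda>(u, v). Close m u v) (support_order sc \<sigma>\<^sub>0 \<Delta> \<Theta>))
    (\<lambda>X \<sigma>'. advances N I \<sigma>\<^sub>0 \<sigma>' \<and> X \<subseteq> set (support_order sc \<sigma>\<^sub>0 \<Delta> \<Theta>) \<and> (\<forall>p\<in>X. p \<in> trusted I \<sigma>') \<and>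
       (\<forall>p\<in>set (support_order sc \<sigma>\<^sub>0 \<Delta> \<Theta>) - X. p \<notin> bisimilarity P))
    (refuted_more N) \<sigma>\<^sub>0"
  proof (rule wp_select_adv)
    fix p \<sigma> assume "p \<in> set (support_order sc \<sigma>\<^sub>0 \<Delta> \<Theta>)" and adv: "advances N I \<sigma>\<^sub>0 \<sigma>" and inv: "consistent N I \<sigma>"
    then obtain u v where p: "p = (u, v)" "u \<in> S" "v \<in> S" using ord supp by auto
    show "wp (case p of (u, v) \<Rightarrow> Close m u v)
      (\<lambda>r \<sigma>'. advances N I \<sigma> \<sigma>' \<and> (if r then p \<in> trusted I \<sigma>' else p \<notin> bisimilarity P)) (refuted_more N) \<sigma>"
      unfolding p prod.case
      by (rule wp_Close) (use inv Match[OF adv p(2,3)] in auto)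
  qed (use assms(1) in auto)
  then show ?thesis
    unfolding MatchDistribution_def wp_bind wp_get wp_ret
  proof (rule wp_mono)
    fix X \<sigma>'
    assume *: "advances N I \<sigma>\<^sub>0 \<sigma>' \<and> X \<subseteq> set (support_order sc \<sigma>\<^sub>0 \<Delta> \<Theta>) \<and> (\<forall>p\<in>X. p \<in> trusted I \<sigma>') \<and>
       (\<forall>p\<in>set (support_order sc \<sigma>\<^sub>0 \<Delta> \<Theta>) - X. p \<notin> bisimilarity P)"
    have "lifting X \<Delta> \<Theta>" if "lifting (bisimilarity P) \<Delta> \<Theta>"
      by (rule lifting_mono[OF lifting_restrict_support[OF _ _ that]])
        (use * assms(2,3) ord in \<open>auto simp: dists_def\<close>)
    moreover have "lifting (trusted I \<sigma>') \<Delta> \<Theta>" if "lifting X \<Delta> \<Theta>"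
      using that * by (auto intro: lifting_mono)
    ultimately show "advances N I \<sigma>\<^sub>0 \<sigma>' \<and> (if Check P \<Delta> \<Theta> X then lifting (trusted I \<sigma>') \<Delta> \<Theta>
        else \<not> lifting (bisimilarity P) \<Delta> \<Theta>)"
      using * by (auto simp: Check_iff_lifting[OF finite_states assms(2,3)])
  qed
qed

lemma wp_MatchAction:
  assumes "consistent N I \<sigma>\<^sub>0" and "s \<in> S" and "t \<in> S" and "a \<in> actions P"
    and Match: "\<And>u v \<sigma>. advances N I \<sigma>\<^sub>0 \<sigma> \<Longrightarrow> u \<in> S \<Longrightarrow> v \<in> S \<Longrightarrow> (u, v) \<notin> Visited \<sigma> \<Longrightarrow>
      Match_correct N I m u v \<sigma>"
  shows "wp (MatchAction P sc m s t a)
    (\<lambda>r \<sigma>'. advances N I \<sigma>\<^sub>0 \<sigma>' \<and>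
       (if r then action_matched (trusted I \<sigma>') s t a else \<not> action_matched (bisimilarity P) s t a))
    (refuted_more N) \<sigma>\<^sub>0"
proof -
  let ?ord = "transition_order sc \<sigma>\<^sub>0 s t a"
  have ord: "set ?ord = derivatives P s a \<times> derivatives P t a"
    using schedule assms(2-4) by (simp add: is_schedule_def enumerates_def)
  have "wp (select (\<lambda>(\<Delta>, \<Theta>). MatchDistribution P sc m \<Delta> \<Theta>) ?ord)
    (\<lambda>X \<sigma>'. advances N I \<sigma>\<^sub>0 \<sigma>' \<and> X \<subseteq> set ?ord \<and> (\<forall>p\<in>X. case_prod (lifting (trusted I \<sigma>')) p) \<and>
       (\<forall>p\<in>set ?ord - X. \<not> case_prod (lifting (bisimilarity P)) p))
    (refuted_more N) \<sigma>\<^sub>0"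
  proof (rule wp_select_adv)
    fix p \<sigma> assume "p \<in> set ?ord" and adv: "advances N I \<sigma>\<^sub>0 \<sigma>" and inv: "consistent N I \<sigma>"
    then obtain \<Delta> \<Theta> where p: "p = (\<Delta>, \<Theta>)" "\<Delta> \<in> dists S" "\<Theta> \<in> dists S"
      using ord derivatives_dists by auto
    show "wp (case p of (\<Delta>, \<Theta>) \<Rightarrow> MatchDistribution P sc m \<Delta> \<Theta>)
      (\<lambda>r \<sigma>'. advances N I \<sigma> \<sigma>' \<and> (if r then case_prod (lifting (trusted I \<sigma>')) p
         else \<not> case_prod (lifting (bisimilarity P)) p)) (refuted_more N) \<sigma>"
      unfolding p prod.case
      by (rule wp_MatchDistribution) (use p inv Match adv_trans[OF adv] in auto)
  next
    fix p W W' assume "case_prod (lifting W) p" "W \<subseteq> (W' :: ('s \<times> 's) set)"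
    then show "case_prod (lifting W') p"
      using lifting_mono by (cases p) auto
  qed (rule assms(1))
  then show ?thesis
    unfolding MatchAction_def wp_bind wp_get wp_ret
  proof (rule wp_mono)
    fix X \<sigma>'
    assume *: "advances N I \<sigma>\<^sub>0 \<sigma>' \<and> X \<subseteq> set ?ord \<and> (\<forall>p\<in>X. case_prod (lifting (trusted I \<sigma>')) p) \<and>
       (\<forall>p\<in>set ?ord - X. \<not> case_prod (lifting (bisimilarity P)) p)"
    have sound: "lifting (trusted I \<sigma>') \<Delta> \<Theta>" if "(\<Delta>, \<Theta>) \<in> X" for \<Delta> \<Theta>
      using * that by auto
    have complete: "(\<Delta>, \<Theta>) \<in> X"
      if "lifting (bisimilarity P) \<Delta> \<Theta>" "\<Delta> \<in> derivatives P s a" "\<Theta> \<in> derivatives P t a" for \<Delta> \<Theta>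
      using * that ord by auto
    show "advances N I \<sigma>\<^sub>0 \<sigma>' \<and> (if (\<forall>\<Delta>\<in>derivatives P s a. \<exists>\<Theta>\<in>derivatives P t a. (\<Delta>, \<Theta>) \<in> X) \<and>
          (\<forall>\<Theta>\<in>derivatives P t a. \<exists>\<Delta>\<in>derivatives P s a. (\<Delta>, \<Theta>) \<in> X)
        then action_matched (trusted I \<sigma>') s t a else \<not> action_matched (bisimilarity P) s t a)"
      (is "_ \<and> (if ?b then _ else _)")
    proof (cases ?b)
      case True
      then have "action_matched (trusted I \<sigma>') s t a"
        unfolding action_matched_def using sound by blast
      with True * show ?thesis by simp
    next
      case False
      then have "\<not> action_matched (bisimilarity P) s t a"
        unfolding action_matched_def using complete by blast
      with False * show ?thesis by auto
    qed
  qed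
qed

text \<open>While the loop runs, \<open>(s, t)\<close> belongs to the pairs in progress. On success
  it leaves them as a matched pair; on failure either someone has assumed it and the exception is
  raised, or no trusted pair depends on it.\<close>

lemma wp_Match_body:
  assumes inv: "consistent N I \<sigma>\<^sub>0" and st: "s \<in> S" "t \<in> S" "(s, t) \<notin> Visited \<sigma>\<^sub>0"
    and Match: "\<And>u v \<sigma>. Visited \<sigma>\<^sub>0 \<union> {(s, t)} \<subseteq> Visited \<sigma> \<Longrightarrow> consistent N (insert (s, t) I) \<sigma> \<Longrightarrow>
      u \<in> S \<Longrightarrow> v \<in> S \<Longrightarrow> (u, v) \<notin> Visited \<sigma> \<Longrightarrow> Match_correct N (insert (s, t) I) m u v \<sigma>"
  shows "Match_correct N I (Match_body P sc m) s t \<sigma>\<^sub>0"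
proof -
  let ?I = "insert (s, t) I"
  define \<sigma>\<^sub>1 where "\<sigma>\<^sub>1 = Visited_update (insert (s, t)) \<sigma>\<^sub>0"
  let ?ord = "action_order sc \<sigma>\<^sub>1 s t"
  have ord: "set ?ord = enabled P s t"
    using schedule st by (simp add: is_schedule_def enumerates_def)
  \<comment> \<open>Marking the pair as visited and in progress at once creates no new matching
    obligation.\<close>
  have "Visited \<sigma>\<^sub>1 - ?I - NotBisim \<sigma>\<^sub>1 = Visited \<sigma>\<^sub>0 - I - NotBisim \<sigma>\<^sub>0"
    using st by (auto simp: \<sigma>\<^sub>1_def)
  then have inv1: "consistent N ?I \<sigma>\<^sub>1"
    using inv st by (auto simp: consistent_def trusted_def \<sigma>\<^sub>1_def)
  have "wp (select (MatchAction P sc m s t) ?ord)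
    (\<lambda>X \<sigma>'. advances N ?I \<sigma>\<^sub>1 \<sigma>' \<and> X \<subseteq> set ?ord \<and> (\<forall>a\<in>X. action_matched (trusted ?I \<sigma>') s t a) \<and>
       (\<forall>a\<in>set ?ord - X. \<not> action_matched (bisimilarity P) s t a))
    (refuted_more N) \<sigma>\<^sub>1"
  proof (rule wp_select_adv)
    fix a \<sigma> assume a: "a \<in> set ?ord" and adv: "advances N ?I \<sigma>\<^sub>1 \<sigma>"
    show "wp (MatchAction P sc m s t a)
      (\<lambda>r \<sigma>'. advances N ?I \<sigma> \<sigma>' \<and> (if r then action_matched (trusted ?I \<sigma>') s t a
         else \<not> action_matched (bisimilarity P) s t a)) (refuted_more N) \<sigma>"
    proof (rule wp_MatchAction)
      show "a \<in> actions P" using a ord by (simp add: enabled_def)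
      fix u v \<sigma>' assume "advances N ?I \<sigma> \<sigma>'" "u \<in> S" "v \<in> S" "(u, v) \<notin> Visited \<sigma>'"
      with adv show "Match_correct N ?I m u v \<sigma>'"
        by (intro Match) (auto simp: advances_def \<sigma>\<^sub>1_def)
    qed (use adv st in \<open>auto simp: advances_def\<close>)
  qed (use inv1 action_matched_mono in auto)
  then have "wp (Match_body P sc m s t) (\<lambda>b \<sigma>'. advances N I \<sigma>\<^sub>0 \<sigma>' \<and> (s, t) \<in> Visited \<sigma>' \<and>
        (if b then matched (trusted I \<sigma>') (s, t) \<and> ((s, t) \<in> NotBisim \<sigma>' \<longrightarrow> (s, t) \<in> NotBisim \<sigma>\<^sub>0)
         else (s, t) \<in> NotBisim \<sigma>'))
       (refuted_more N) \<sigma>\<^sub>0"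
    unfolding Match_body_def wp_bind wp_get wp_modify \<sigma>\<^sub>1_def[symmetric]
  proof (rule wp_mono)
    fix X \<sigma>'
    assume *: "advances N ?I \<sigma>\<^sub>1 \<sigma>' \<and> X \<subseteq> set ?ord \<and> (\<forall>a\<in>X. action_matched (trusted ?I \<sigma>') s t a) \<and>
       (\<forall>a\<in>set ?ord - X. \<not> action_matched (bisimilarity P) s t a)"
    let ?b = "\<forall>a\<in>enabled P s t. a \<in> X"
    have st': "(s, t) \<in> Visited \<sigma>'" using * by (auto simp: advances_def \<sigma>\<^sub>1_def)
    have inv': "consistent N ?I \<sigma>'" using * by (simp add: advances_def)
    show "wp (let b = ?b in if b then ret True else do {
            modify (NotBisim_update (insert (s, t)));
            \<sigma>'' \<leftarrow> get;
            if (s, t) \<in> Assumed \<sigma>'' then raise_wrong else ret False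
          })
        (\<lambda>b \<sigma>'. advances N I \<sigma>\<^sub>0 \<sigma>' \<and> (s, t) \<in> Visited \<sigma>' \<and>
          (if b then matched (trusted I \<sigma>') (s, t) \<and> ((s, t) \<in> NotBisim \<sigma>' \<longrightarrow> (s, t) \<in> NotBisim \<sigma>\<^sub>0)
           else (s, t) \<in> NotBisim \<sigma>'))
        (refuted_more N) \<sigma>'"
    proof (cases ?b)
      case True
      have sub: "trusted ?I \<sigma>' \<subseteq> trusted I \<sigma>'" by (auto simp: trusted_def)
      have "matched (trusted ?I \<sigma>') (s, t)"
        using True * by (simp add: matched_def)
      then have m: "matched (trusted I \<sigma>') (s, t)" using sub by (rule matched_mono)
      have "matched (trusted I \<sigma>') p" if "p \<in> Visited \<sigma>' - I - NotBisim \<sigma>'" for p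
      proof (cases "p = (s, t)")
        case False
        then have "matched (trusted ?I \<sigma>') p" using that inv' by (simp add: consistent_def)
        then show ?thesis using sub by (rule matched_mono)
      qed (simp add: m)
      then have "consistent N I \<sigma>'" using inv' by (simp add: consistent_def)
      then have "advances N I \<sigma>\<^sub>0 \<sigma>'" using * by (auto simp: advances_def \<sigma>\<^sub>1_def)
      with True m st' * show ?thesis by (auto simp: advances_def \<sigma>\<^sub>1_def)
    next
      case False
      let ?\<sigma> = "NotBisim_update (insert (s, t)) \<sigma>'"
      have "\<not> matched (bisimilarity P) (s, t)"
        using False * ord by (auto simp: matched_def)
      then have nb: "(s, t) \<notin> bisimilarity P"
        using bisimilar_matched by blast
      show ?thesis
      proof (cases "(s, t) \<in> Assumed \<sigma>'")
        case True
        \<comment> \<open>Assumed pairs lie outside \<open>NotBisim\<close>, so inserting this one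
          is a strict enlargement.\<close>
        then have "(s, t) \<notin> NotBisim \<sigma>'" using inv' by (auto simp: consistent_def)
        then have "refuted_more N ?\<sigma>"
          using inv' nb st by (auto simp: refuted_more_def consistent_def)
        with True \<open>\<not> ?b\<close> show ?thesis by auto
      next
        case notAssumed: False
        \<comment> \<open>The failed pair passes from in progress to refuted, so it was untrusted
          before and stays so. The trusted set and its obligations do not change.\<close>
        have "Visited ?\<sigma> - I - NotBisim ?\<sigma> = Visited \<sigma>' - ?I - NotBisim \<sigma>'" by auto
        then have "consistent N I ?\<sigma>"
          using inv' nb st notAssumed by (auto simp: consistent_def trusted_def)
        \<comment> \<open>Refuting \<open>(s, t)\<close> is compatible with \<open>advances\<close>
          because this pair was unvisited in \<open>\<sigma>\<^sub>0\<close>.\<close>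
        then have "advances N I \<sigma>\<^sub>0 ?\<sigma>"
          using * st by (auto simp: advances_def \<sigma>\<^sub>1_def)
        with st' notAssumed False show ?thesis by auto
      qed
    qed
  qed
  then show ?thesis by (simp add: Match_correct_def)
qed

section \<open>Closing the recursion and handling restarts\<close>

lemma Match_correct:
  assumes "consistent N I \<sigma>" and "s \<in> S" and "t \<in> S" and "(s, t) \<notin> Visited \<sigma>"
  shows "Match_correct N I (Match P sc) s t \<sigma>"
  using assms
\<comment> \<open>The measure counts the unvisited pairs. \<open>I\<close> is generalized since each
  level of recursion adds its own pair to it.\<close>
proof (induction "card (S \<times> S - Visited \<sigma>)" arbitrary: I s t \<sigma> rule: less_induct)
  case less
  have "Match_correct N I (Match_body P sc (Match P sc)) s t \<sigma>"
  proof (rule wp_Match_body[OF less.prems])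
    fix u v \<sigma>' assume "Visited \<sigma> \<union> {(s, t)} \<subseteq> Visited \<sigma>'" and *: "consistent N (insert (s, t) I) \<sigma>'"
      "u \<in> S" "v \<in> S" "(u, v) \<notin> Visited \<sigma>'"
    then have "card (S \<times> S - Visited \<sigma>') < card (S \<times> S - Visited \<sigma>)"
      using finite_states less.prems by (intro psubset_card_mono) auto
    then show "Match_correct N (insert (s, t) I) (Match P sc) u v \<sigma>'"
      using * by (rule less.hyps)
  qed
  moreover have "Match P sc s t = Match_body P sc (Match P sc) s t"
    by (rule ext, subst Match.simps) simp
  ultimately show ?case by (simp add: Match_correct_def)
qed

text \<open>At the top level no call is in progress at the end, and assumed pairs are visited and
  unrefuted. Hence \<open>trusted {}\<close> is exactly the set of visited pairs outside
  \<open>NotBisim\<close>, and it matches each of its members.\<close>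

lemma wp_Bis_attempt:
  assumes "s \<in> S" and "t \<in> S" and "NotBisim \<sigma> \<subseteq> S \<times> S - bisimilarity P"
  shows "wp (Bis_attempt P sc s t) (\<lambda>b _. b \<longleftrightarrow> (s, t) \<in> bisimilarity P)
    (refuted_more (NotBisim \<sigma>)) \<sigma>"
proof -
  define \<sigma>\<^sub>0 where "\<sigma>\<^sub>0 = Assumed_update (\<lambda>_. {}) (Visited_update (\<lambda>_. {}) \<sigma>)"
  have "consistent (NotBisim \<sigma>) {} \<sigma>\<^sub>0"
    using assms by (simp add: consistent_def \<sigma>\<^sub>0_def)
  then have "Match_correct (NotBisim \<sigma>) {} (Match P sc) s t \<sigma>\<^sub>0"
    using assms by (intro Match_correct) (simp_all add: \<sigma>\<^sub>0_def)
  then show ?thesis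
    unfolding Bis_attempt_def wp_bind wp_modify Match_correct_def \<sigma>\<^sub>0_def[symmetric]
  proof (rule wp_mono)
    fix b \<sigma>'
    assume *: "advances (NotBisim \<sigma>) {} \<sigma>\<^sub>0 \<sigma>' \<and> (s, t) \<in> Visited \<sigma>' \<and>
        (if b then matched (trusted {} \<sigma>') (s, t) \<and> ((s, t) \<in> NotBisim \<sigma>' \<longrightarrow> (s, t) \<in> NotBisim \<sigma>\<^sub>0)
         else (s, t) \<in> NotBisim \<sigma>')"
    then have inv: "consistent (NotBisim \<sigma>) {} \<sigma>'" by (simp add: advances_def)
    show "b \<longleftrightarrow> (s, t) \<in> bisimilarity P"
    proof (cases b)
      case True
      \<comment> \<open>The outermost call of \<open>Match\<close> is not guarded by \<open>Close\<close>, so \<open>(s, t)\<close> might be in \<open>NotBisim\<close>.\<close>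
      let ?R = "insert (s, t) (Visited \<sigma>' - NotBisim \<sigma>')"
      have sub: "trusted {} \<sigma>' \<subseteq> ?R"
        using inv by (auto simp: trusted_def consistent_def)
      have "(s, t) \<in> bisimilarity P"
      proof (rule bisimilarI)
        show "?R \<subseteq> S \<times> S" using inv assms by (auto simp: consistent_def)
        show "matched ?R p" if "p \<in> ?R" for p
          by (rule matched_mono[OF _ sub]) (use that True * inv in \<open>auto simp: consistent_def\<close>)
      qed simp
      with True show ?thesis by simp
    next
      case False
      then show ?thesis using * inv by (auto simp: consistent_def)
    qed
  qed
qed

lemma Bis_correct:
  assumes "s \<in> S" and "t \<in> S" and "NotBisim \<sigma> \<subseteq> S \<times> S - bisimilarity P"
  shows "Bis P sc s t \<sigma> = Some ((s, t) \<in> bisimilarity P)"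
  using assms(3)
proof (induction "card (S \<times> S - NotBisim \<sigma>)" arbitrary: \<sigma> rule: less_induct)
  case less
  from wp_Bis_attempt[OF assms(1,2) less.prems] obtain out \<sigma>' where
    out: "Bis_attempt P sc s t \<sigma> = Some (out, \<sigma>')" "case out of
      Returned b \<Rightarrow> b \<longleftrightarrow> (s, t) \<in> bisimilarity P | WrongAssumption \<Rightarrow> refuted_more (NotBisim \<sigma>) \<sigma>'"
    unfolding wp_def by (cases "Bis_attempt P sc s t \<sigma>") auto
  show ?case
  proof (cases out)
    case (Returned b)
    with out show ?thesis by (subst Bis.simps) simp
  next
    case WrongAssumption
    with out have "NotBisim \<sigma> \<subset> NotBisim \<sigma>'" and ref: "NotBisim \<sigma>' \<subseteq> S \<times> S - bisimilarity P"
      by (simp_all add: refuted_more_def)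
    \<comment> \<open>By \<open>ref\<close>, the newly refuted pairs lie in
      \<open>S \<times> S\<close>, so the finite measure really drops.\<close>
    then have "card (S \<times> S - NotBisim \<sigma>') < card (S \<times> S - NotBisim \<sigma>)"
      using finite_states by (intro psubset_card_mono) auto
    then have "Bis P sc s t \<sigma>' = Some ((s, t) \<in> bisimilarity P)"
      using ref by (rule less.hyps)
    with WrongAssumption out show ?thesis by (subst Bis.simps) simp
  qed
qed

end

theorem theorem7p2:
  fixes P :: "('s, 'a) plts" and sc :: "('s, 'a) schedule" and s0 t0 :: 's
  assumes "is_plts P" and "finitary P"
    and "s0 \<in> states P" and "t0 \<in> states P"
    and "is_schedule P sc"
  shows "\<exists>b. Bisim P sc s0 t0 = Some b \<and> (b \<longleftrightarrow> (s0, t0) \<in> bisimilarity P)"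
proof -
  interpret scheduled_plts P sc
    using assms by unfold_locales
  show ?thesis
    using assms(3,4) by (simp add: Bisim_def Bis_correct)
qed

end
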